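(* Extension Roman Hitting Set is solvable in polynomial time.
   Context: A hypergraph is $H=(X,(s_i)_{i\in I})$ with finite $X$, finite index set $I$, $s_i\subseteq X$ (repetitions allowed). A pair $(R_1,R_2)$ with $R_1\subseteq I$, $R_2\subseteq X$ is a Roman hitting set (rhs) if for every $i\in I$, $s_i\cap R_2\ne\emptyset$ or $i\in R_1$. Pairs are ordered componentwise by inclusion: $(P_1,P_2)\le(R_1,R_2)$ iff $P_1\subseteq R_1$ and $P_2\subseteq R_2$; an rhs $P$ is minimal if every rhs $R\le P$ equals $P$. Extension Roman Hitting Set: given $H$ and a pair $U=(U_1,U_2)$ with $U_1\subseteq I$, $U_2\subseteq X$, decide whether there is a minimal rhs $R$ of $H$ with $U\le R$. *)

theory Defs
  imports Main "HOL-Library.Product_Order" "HOL-Computational_Algebra.Polynomial"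
begin

section \<open>Hypergraphs and Roman hitting sets\<close>

record ('x, 'i) hypergraph =
  vertices :: "'x set"
  indices :: "'i set"
  edge :: "'i \<Rightarrow> 'x set"

definition is_hypergraph :: "('x, 'i) hypergraph \<Rightarrow> bool" where
  "is_hypergraph H \<longleftrightarrow>
     finite (vertices H) \<and> finite (indices H) \<and> (\<forall>i\<in>indices H. edge H i \<subseteq> vertices H)"

definition is_pair :: "('x, 'i) hypergraph \<Rightarrow> 'i set \<times> 'x set \<Rightarrow> bool" where
  "is_pair H R \<longleftrightarrow> fst R \<subseteq> indices H \<and> snd R \<subseteq> vertices H"

definition rhs :: "('x, 'i) hypergraph \<Rightarrow> 'i set \<times> 'x set \<Rightarrow> bool" where
  "rhs H R \<longleftrightarrow> is_pair H R \<and> (\<forall>i\<in>indices H. edge H i \<inter> snd R \<noteq> {} \<or> i \<in> fst R)"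

text \<open>The order \<open>\<le>\<close> on pairs is the componentwise one of \<^theory>\<open>HOL-Library.Product_Order\<close>,
  which on pairs of sets is componentwise inclusion.\<close>

definition minimal_rhs :: "('x, 'i) hypergraph \<Rightarrow> 'i set \<times> 'x set \<Rightarrow> bool" where
  "minimal_rhs H P \<longleftrightarrow> rhs H P \<and> (\<forall>R. rhs H R \<and> R \<le> P \<longrightarrow> R = P)"

definition ext_rhs :: "('x, 'i) hypergraph \<Rightarrow> 'i set \<times> 'x set \<Rightarrow> bool" where
  "ext_rhs H U \<longleftrightarrow> (\<exists>R. minimal_rhs H R \<and> U \<le> R)"

section \<open>Instances as binary strings\<close>

text \<open>Relative to enumerations \<open>xs\<close> of the vertices and \<open>js\<close> of the indices, an instance
  \<open>(H, (U\<^sub>1, U\<^sub>2))\<close> is written as the number of vertices in unary, the characteristic vector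
  of \<open>U\<^sub>2\<close>, and then, for each index \<open>i\<close>, one bit for \<open>i \<in> U\<^sub>1\<close> followed by the row of the
  incidence matrix belonging to \<open>i\<close>.\<close>

definition encode ::
  "'x list \<Rightarrow> 'i list \<Rightarrow> ('x, 'i) hypergraph \<Rightarrow> 'i set \<times> 'x set \<Rightarrow> bool list" where
  "encode xs js H U =
     replicate (length xs) True @ [False] @
     map (\<lambda>x. x \<in> snd U) xs @
     concat (map (\<lambda>i. (i \<in> fst U) # map (\<lambda>x. x \<in> edge H i) xs) js)"

definition is_enumeration :: "'a list \<Rightarrow> 'a set \<Rightarrow> bool" where
  "is_enumeration xs A \<longleftrightarrow> distinct xs \<and> set xs = A"

text \<open>Vertices and indices are natural numbers so that one language covers all finite
  hypergraphs up to renaming.\<close>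

definition ext_rhs_language :: "bool list set" where
  "ext_rhs_language =
     {encode xs js H U | xs js (H :: (nat, nat) hypergraph) U.
        is_hypergraph H \<and> is_pair H U \<and>
        is_enumeration xs (vertices H) \<and> is_enumeration js (indices H) \<and>
        ext_rhs H U}"

text \<open>The encoding determines the instance up to renaming vertices and indices, so no string
  encodes both a yes-instance and a no-instance.\<close>

lemma replicate_True_False_inject:
  assumes "replicate m True @ False # u = replicate n True @ False # v"
  shows "m = n \<and> u = v"
  using assms
proof (induction m arbitrary: n)
  case 0
  then show ?case by (cases n) auto
next
  case (Suc m)
  then show ?case by (cases n) auto
qed

lemma concat_map_inject:
  assumes "concat (map f as) = concat (map g bs)"
    and "\<And>a. length (f a) = Suc k" and "\<And>b. length (g b) = Suc k"
  shows "map f as = map g bs"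
  using assms(1)
proof (induction as arbitrary: bs)
  case Nil
  show ?case
  proof (cases bs)
    case (Cons b cs)
    then have "g b = []" using Nil by simp
    then show ?thesis using assms(3)[of b] by simp
  qed simp
next
  case (Cons a as)
  show ?case
  proof (cases bs)
    case Nil
    then have "f a = []" using Cons.prems by simp
    then show ?thesis using assms(2)[of a] by simp
  next
    case (Cons b cs)
    then show ?thesis using Cons.prems Cons.IH[of cs] assms(2)[of a] assms(3)[of b] by simp
  qed
qed

lemma encode_inject:
  assumes "encode xs js H U = encode xs' js' H' U'"
  shows "length xs = length xs'" and "length js = length js'"
    and "\<And>k. k < length xs \<Longrightarrow> xs ! k \<in> snd U \<longleftrightarrow> xs' ! k \<in> snd U'"
    and "\<And>l. l < length js \<Longrightarrow> js ! l \<in> fst U \<longleftrightarrow> js' ! l \<in> fst U'"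
    and "\<And>k l. k < length xs \<Longrightarrow> l < length js \<Longrightarrow>
           xs ! k \<in> edge H (js ! l) \<longleftrightarrow> xs' ! k \<in> edge H' (js' ! l)"
proof -
  let ?f = "\<lambda>i. (i \<in> fst U) # map (\<lambda>x. x \<in> edge H i) xs"
  let ?g = "\<lambda>i. (i \<in> fst U') # map (\<lambda>x. x \<in> edge H' i) xs'"
  have len: "length xs = length xs'"
    and rest: "map (\<lambda>x. x \<in> snd U) xs @ concat (map ?f js)
             = map (\<lambda>x. x \<in> snd U') xs' @ concat (map ?g js')"
    using replicate_True_False_inject assms unfolding encode_def append_Cons append_Nil by blast+
  show "length xs = length xs'" by (fact len)
  have vec: "map (\<lambda>x. x \<in> snd U) xs = map (\<lambda>x. x \<in> snd U') xs'"
    and "concat (map ?f js) = concat (map ?g js')"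
    using rest len by simp_all
  then have rows: "map ?f js = map ?g js'"
    using len by (intro concat_map_inject[where k = "length xs"]) simp_all
  show ljs: "length js = length js'" using arg_cong[OF rows, of length] by simp
  show "xs ! k \<in> snd U \<longleftrightarrow> xs' ! k \<in> snd U'" if "k < length xs" for k
    using arg_cong[OF vec, of "\<lambda>v. v ! k"] that len by simp
  have row: "?f (js ! l) = ?g (js' ! l)" if "l < length js" for l
    using arg_cong[OF rows, of "\<lambda>v. v ! l"] that ljs by simp
  show "js ! l \<in> fst U \<longleftrightarrow> js' ! l \<in> fst U'" if "l < length js" for l
    using row[OF that] by simp
  show "xs ! k \<in> edge H (js ! l) \<longleftrightarrow> xs' ! k \<in> edge H' (js' ! l)"
    if "k < length xs" "l < length js" for k l
  proof -
    have "map (\<lambda>x. x \<in> edge H (js ! l)) xs = map (\<lambda>x. x \<in> edge H' (js' ! l)) xs'"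
      using row[OF that(2)] by simp
    from arg_cong[OF this, of "\<lambda>v. v ! k"] show ?thesis using that(1) len by simp
  qed
qed

section \<open>Polynomial time on deterministic multi-tape Turing machines\<close>

datatype direction = Go_Left | Stay | Go_Right

text \<open>States and tape symbols are initial segments of the natural numbers: state 0 is the
  start state, 1 and 2 are the accepting and the rejecting halting states; symbol 0 is the
  blank, 1 and 2 represent the input bits. The transition function maps a state and the symbols
  under the heads to a state and, for each tape, a symbol to write and a head movement.\<close>

record tm =
  num_tapes :: nat
  num_states :: nat
  num_symbols :: nat
  delta :: "nat \<Rightarrow> nat list \<Rightarrow> nat \<times> (nat \<times> direction) list"

definition accept_state :: nat where "accept_state = 1"

definition reject_state :: nat where "reject_state = 2"

definition is_tm :: "tm \<Rightarrow> bool" where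
  "is_tm M \<longleftrightarrow>
     num_tapes M \<ge> 1 \<and> num_states M \<ge> 3 \<and> num_symbols M \<ge> 3 \<and>
     (\<forall>q ss. q < num_states M \<and> length ss = num_tapes M \<and> (\<forall>s\<in>set ss. s < num_symbols M) \<longrightarrow>
        (case delta M q ss of (q', acts) \<Rightarrow>
           q' < num_states M \<and> length acts = num_tapes M \<and>
           (\<forall>(s, d)\<in>set acts. s < num_symbols M)))"

text \<open>A tape, infinite in both directions, is given by its head position and its contents.\<close>

type_synonym tape = "int \<times> (int \<Rightarrow> nat)"

type_synonym config = "nat \<times> tape list"

fun read_tape :: "tape \<Rightarrow> nat" where
  "read_tape (h, c) = c h"

fun move :: "direction \<Rightarrow> int \<Rightarrow> int" where
  "move Go_Left h = h - 1"
| "move Stay h = h"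
| "move Go_Right h = h + 1"

fun act_tape :: "nat \<times> direction \<Rightarrow> tape \<Rightarrow> tape" where
  "act_tape (s, d) (h, c) = (move d h, c(h := s))"

fun step :: "tm \<Rightarrow> config \<Rightarrow> config" where
  "step M (q, ts) =
     (if q = accept_state \<or> q = reject_state then (q, ts)
      else case delta M q (map read_tape ts) of (q', acts) \<Rightarrow> (q', map2 act_tape acts ts))"

definition input_tape :: "bool list \<Rightarrow> tape" where
  "input_tape w =
     (0, \<lambda>p. if 0 \<le> p \<and> p < int (length w) then (if w ! nat p then 2 else 1) else 0)"

definition blank_tape :: tape where
  "blank_tape = (0, \<lambda>_. 0)"

definition initial_config :: "tm \<Rightarrow> bool list \<Rightarrow> config" where
  "initial_config M w = (0, input_tape w # replicate (num_tapes M - 1) blank_tape)"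

definition decides_in_time :: "tm \<Rightarrow> bool list set \<Rightarrow> (nat \<Rightarrow> nat) \<Rightarrow> bool" where
  "decides_in_time M L T \<longleftrightarrow>
     (\<forall>w. \<exists>t \<le> T (length w).
        fst ((step M ^^ t) (initial_config M w)) =
          (if w \<in> L then accept_state else reject_state))"

definition PTIME :: "bool list set set" where
  "PTIME = {L. \<exists>M (p :: nat poly). is_tm M \<and> decides_in_time M L (poly p)}"

end

theory Submission
  imports Defs
begin

text \<open>Shrinking \<open>R\<^sub>2\<close> to \<open>U\<^sub>2\<close> keeps private edges private and only enlarges the set of unhit
  edges, so \<open>U\<close> extends to a minimal rhs iff no edge indexed by \<open>U\<^sub>1\<close> meets \<open>U\<^sub>2\<close> and every
  vertex of \<open>U\<^sub>2\<close> is the only vertex of \<open>U\<^sub>2\<close> in some edge. A two-tape machine tests this in linear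
  time: it keeps \<open>U\<^sub>2\<close> on the second tape between two end markers and compares it with each row
  of the input. The first vertex of \<open>U\<^sub>2\<close> met in a row is marked tentatively; on the way back to the
  left end the mark is made permanent if it was the only one in the row, and erased otherwise.
  Finally all of \<open>U\<^sub>2\<close> must be marked.\<close>

section \<open>Extendable pairs\<close>

text \<open>Dropping from the first component every index whose edge is hit leaves an rhs, so
  minimality keeps exactly the unhit ones. If deleting \<open>x\<close> from the second component
  destroys the rhs property, some edge was hit by \<open>x\<close> alone. Conversely, these private
  edges force a smaller rhs to keep all vertices, and then all unhit indices.\<close>

lemma minimal_rhs_iff:
  "minimal_rhs H R \<longleftrightarrow> is_pair H R \<and> fst R = {i \<in> indices H. edge H i \<inter> snd R = {}} \<and>
     (\<forall>x\<in>snd R. \<exists>i\<in>indices H. edge H i \<inter> snd R = {x})"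
  (is "_ \<longleftrightarrow> _ \<and> ?unhit \<and> ?private")
proof
  assume m: "minimal_rhs H R"
  then have r: "rhs H R" and min: "\<And>S. rhs H S \<Longrightarrow> S \<le> R \<Longrightarrow> S = R"
    unfolding minimal_rhs_def by blast+
  let ?S = "({i \<in> indices H. edge H i \<inter> snd R = {}}, snd R)"
  have "rhs H ?S" "?S \<le> R"
    using r by (auto simp: rhs_def is_pair_def less_eq_prod_def)
  then have "?S = R" by (rule min)
  from arg_cong[OF this, of fst] have unhit: ?unhit by simp
  have ?private
  proof
    fix x assume x: "x \<in> snd R"
    let ?T = "(fst R, snd R - {x})"
    have "?T \<le> R" "?T \<noteq> R" using x by (auto simp: less_eq_prod_def prod_eq_iff)
    then have "\<not> rhs H ?T" using min by blast
    then obtain i where i: "i \<in> indices H" "edge H i \<inter> (snd R - {x}) = {}" "i \<notin> fst R"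
      using r by (auto simp: rhs_def is_pair_def)
    then have "edge H i \<inter> snd R \<noteq> {}" using unhit by auto
    with i show "\<exists>i\<in>indices H. edge H i \<inter> snd R = {x}" by (intro bexI[of _ i]) auto
  qed
  then show "is_pair H R \<and> ?unhit \<and> ?private" using r unhit by (simp add: rhs_def)
next
  assume a: "is_pair H R \<and> ?unhit \<and> ?private"
  from a have unhit: ?unhit by (elim conjE)
  from a have priv: ?private by (elim conjE)
  have r: "rhs H R" using a unfolding rhs_def by simp
  have "S = R" if S: "rhs H S" "S \<le> R" for S
  proof -
    have sub: "fst S \<subseteq> fst R" "snd S \<subseteq> snd R" using S by (auto simp: less_eq_prod_def)
    have "x \<in> snd S" if x: "x \<in> snd R" for x
    proof -
      obtain i where i: "i \<in> indices H" "edge H i \<inter> snd R = {x}" using priv x by blast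
      \<comment> \<open>The private edge of \<open>x\<close> cannot be covered by its index, so
        \<open>S\<close> must hit it, and \<open>x\<close> is the only vertex available.\<close>
      then have "i \<notin> fst R" using unhit by simp
      then have "edge H i \<inter> snd S \<noteq> {}" using S(1) sub(1) i(1) unfolding rhs_def by blast
      then obtain y where "y \<in> edge H i" "y \<in> snd S" by blast
      moreover from this have "y \<in> edge H i \<inter> snd R" using sub(2) by blast
      ultimately show ?thesis using i(2) by simp
    qed
    then have "snd S = snd R" using sub by blast
    moreover have "fst R \<subseteq> fst S"
    proof
      fix i assume "i \<in> fst R"
      then have "i \<in> indices H" "edge H i \<inter> snd S = {}" using unhit \<open>snd S = snd R\<close> by simp_all
      then show "i \<in> fst S" using S(1) unfolding rhs_def by blast
    qed
    ultimately show ?thesis using sub by (simp add: prod_eq_iff)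
  qed
  then show "minimal_rhs H R" using r by (auto simp: minimal_rhs_def)
qed

text \<open>This removes the search for \<open>R\<close>: if any extension exists, then so does the
  one that adds no vertex and takes the indices of all unhit edges.\<close>

lemma ext_rhs_iff:
  assumes "is_pair H U"
  shows "ext_rhs H U \<longleftrightarrow> (\<forall>i\<in>fst U. edge H i \<inter> snd U = {}) \<and>
     (\<forall>x\<in>snd U. \<exists>i\<in>indices H. edge H i \<inter> snd U = {x})"
proof
  assume "ext_rhs H U"
  then obtain R where R: "minimal_rhs H R" "fst U \<subseteq> fst R" "snd U \<subseteq> snd R"
    by (auto simp: ext_rhs_def less_eq_prod_def)
  have "edge H i \<inter> snd U = {}" if "i \<in> fst U" for i
    using R that by (auto simp: minimal_rhs_iff)
  moreover have "\<exists>i\<in>indices H. edge H i \<inter> snd U = {x}" if x: "x \<in> snd U" for x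
  proof -
    obtain i where "i \<in> indices H" "edge H i \<inter> snd R = {x}"
      using R(1,3) x unfolding minimal_rhs_iff by blast
    then show ?thesis using R(3) x by (intro bexI[of _ i]) auto
  qed
  ultimately show "(\<forall>i\<in>fst U. edge H i \<inter> snd U = {}) \<and>
     (\<forall>x\<in>snd U. \<exists>i\<in>indices H. edge H i \<inter> snd U = {x})" by blast
next
  assume a: "(\<forall>i\<in>fst U. edge H i \<inter> snd U = {}) \<and>
     (\<forall>x\<in>snd U. \<exists>i\<in>indices H. edge H i \<inter> snd U = {x})"
  let ?R = "({i \<in> indices H. edge H i \<inter> snd U = {}}, snd U)"
  have "minimal_rhs H ?R" "U \<le> ?R"
    using a assms by (auto simp: minimal_rhs_iff is_pair_def less_eq_prod_def)
  then show "ext_rhs H U" unfolding ext_rhs_def by blast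
qed

section \<open>Words of bits in place of hypergraphs\<close>

text \<open>A row consists of the bit for membership of its index in \<open>U\<^sub>1\<close> and the incidence vector of
  its edge; \<open>u\<close> is the characteristic vector of \<open>U\<^sub>2\<close>.\<close>

definition extendable :: "bool list \<Rightarrow> (bool \<times> bool list) list \<Rightarrow> bool" where
  "extendable u rows \<longleftrightarrow>
     (\<forall>(b, r)\<in>set rows. b \<longrightarrow> (\<forall>k<length u. \<not> (r ! k \<and> u ! k))) \<and>
     (\<forall>k<length u. u ! k \<longrightarrow> (\<exists>(b, r)\<in>set rows. \<forall>j<length u. r ! j \<and> u ! j \<longleftrightarrow> j = k))"

definition word_of :: "bool list \<Rightarrow> (bool \<times> bool list) list \<Rightarrow> bool list" where
  "word_of u rows = replicate (length u) True @ False # u @ concat (map (\<lambda>(b, r). b # r) rows)"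

text \<open>The criterion of \<open>ext_rhs_iff\<close> depends only on positions in the
  enumerations. Conversely, every well-formed word is realized by a hypergraph on initial segments
  of the naturals, enumerated in increasing order.\<close>

lemma ext_rhs_language_eq:
  "ext_rhs_language =
     {word_of u rows | u rows. (\<forall>(b, r)\<in>set rows. length r = length u) \<and> extendable u rows}"
proof (intro equalityI subsetI)
  fix w assume "w \<in> ext_rhs_language"
  then obtain xs js and H :: "(nat, nat) hypergraph" and U where
    w: "w = encode xs js H U" and H: "is_hypergraph H" and U: "is_pair H U"
    and xs: "distinct xs" "set xs = vertices H" and js: "set js = indices H"
    and ext: "ext_rhs H U"
    unfolding ext_rhs_language_def is_enumeration_def by blast
  let ?u = "map (\<lambda>x. x \<in> snd U) xs"
  let ?rows = "map (\<lambda>i. (i \<in> fst U, map (\<lambda>x. x \<in> edge H i) xs)) js"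
  have "w = word_of ?u ?rows" by (simp add: w encode_def word_of_def comp_def)
  moreover have "\<forall>(b, r)\<in>set ?rows. length r = length ?u" by auto
  moreover have "extendable ?u ?rows"
    unfolding extendable_def
  proof (intro conjI allI impI)
    show "\<forall>(b, r)\<in>set ?rows. b \<longrightarrow> (\<forall>k<length ?u. \<not> (r ! k \<and> ?u ! k))"
      using ext U by (auto simp: ext_rhs_iff)
    fix k assume k: "k < length ?u" "?u ! k"
    then obtain i where i: "i \<in> indices H" "edge H i \<inter> snd U = {xs ! k}"
      using ext U by (auto simp: ext_rhs_iff)
    \<comment> \<open>Distinctness of \<open>xs\<close> turns uniqueness of the vertex into
      uniqueness of its position.\<close>
    have "xs ! j \<in> edge H i \<and> xs ! j \<in> snd U \<longleftrightarrow> j = k" if "j < length xs" for j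
    proof -
      have "xs ! j \<in> edge H i \<and> xs ! j \<in> snd U \<longleftrightarrow> xs ! j = xs ! k" using i(2) by blast
      then show ?thesis using that k(1) xs(1) by (simp add: nth_eq_iff_index_eq)
    qed
    then show "\<exists>(b, r)\<in>set ?rows. \<forall>j<length ?u. r ! j \<and> ?u ! j \<longleftrightarrow> j = k"
      using i(1) js by (intro bexI[of _ "(i \<in> fst U, map (\<lambda>x. x \<in> edge H i) xs)"]) auto
  qed
  ultimately show "w \<in> {word_of u rows | u rows.
      (\<forall>(b, r)\<in>set rows. length r = length u) \<and> extendable u rows}"
    by (intro CollectI exI conjI)
next
  fix w assume "w \<in> {word_of u rows | u rows.
      (\<forall>(b, r)\<in>set rows. length r = length u) \<and> extendable u rows}"
  then obtain u rows where w: "w = word_of u rows"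
    and len: "\<And>b r. (b, r) \<in> set rows \<Longrightarrow> length r = length u" and e: "extendable u rows" by blast
  define H :: "(nat, nat) hypergraph" where
    "H = \<lparr>vertices = {..<length u}, indices = {..<length rows},
          edge = (\<lambda>i. {k. k < length u \<and> snd (rows ! i) ! k})\<rparr>"
  define U where "U = ({i. i < length rows \<and> fst (rows ! i)}, {k. k < length u \<and> u ! k})"
  have H: "is_hypergraph H" by (auto simp: is_hypergraph_def H_def)
  have U: "is_pair H U" by (auto simp: is_pair_def H_def U_def)
  have "ext_rhs H U"
    unfolding ext_rhs_iff[OF U]
  proof (intro conjI ballI)
    fix i assume i: "i \<in> fst U"
    then have "rows ! i \<in> set rows" by (simp add: U_def)
    then have "fst (rows ! i) \<longrightarrow> (\<forall>k<length u. \<not> (snd (rows ! i) ! k \<and> u ! k))"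
      using e unfolding extendable_def split_beta by blast
    then show "edge H i \<inter> snd U = {}" using i by (auto simp: U_def H_def)
  next
    fix k assume k: "k \<in> snd U"
    then obtain b r where "(b, r) \<in> set rows" and
      r: "\<forall>j<length u. r ! j \<and> u ! j \<longleftrightarrow> j = k"
      using e by (auto simp: extendable_def U_def)
    then obtain i where i: "i < length rows" "rows ! i = (b, r)" by (auto simp: in_set_conv_nth)
    then show "\<exists>i\<in>indices H. edge H i \<inter> snd U = {k}"
      using r k by (intro bexI[of _ i]) (auto simp: H_def U_def)
  qed
  moreover have "w = encode [0..<length u] [0..<length rows] H U"
  proof -
    have "map (\<lambda>x. x \<in> snd U) [0..<length u] = u"
      by (rule nth_equalityI) (auto simp: U_def)
    moreover have "map (\<lambda>(b, r). b # r) rows =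
        map (\<lambda>i. (i \<in> fst U) # map (\<lambda>x. x \<in> edge H i) [0..<length u]) [0..<length rows]"
    proof (rule nth_equalityI, goal_cases)
      case (2 i)
      obtain b r where br: "rows ! i = (b, r)" by fastforce
      then have "length r = length u" using 2 len nth_mem[of i rows] by auto
      then have "map (\<lambda>x. x \<in> edge H i) [0..<length u] = r"
        by (intro nth_equalityI) (auto simp: H_def br)
      then show ?case using 2 br by (simp add: U_def)
    qed simp
    ultimately show ?thesis by (simp add: w word_of_def encode_def)
  qed
  moreover have "is_enumeration [0..<length u] (vertices H)"
    "is_enumeration [0..<length rows] (indices H)"
    by (auto simp: is_enumeration_def H_def)
  ultimately show "w \<in> ext_rhs_language"
    unfolding ext_rhs_language_def using H U by blast
qed

section \<open>A recursive decision procedure\<close>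

text \<open>Symbols of the second tape: the cell of a vertex is \<open>out\<close> if it is not in \<open>U\<^sub>2\<close>, and
  otherwise \<open>todo\<close>, \<open>marked\<close> or \<open>tentative\<close>, according to whether a private edge was found.\<close>

abbreviation (input) "out \<equiv> 1 :: nat"
abbreviation (input) "todo \<equiv> 2 :: nat"
abbreviation (input) "marked \<equiv> 3 :: nat"
abbreviation (input) "tentative \<equiv> 4 :: nat"
abbreviation (input) "end_marker \<equiv> 5 :: nat"

text \<open>The invariant of the second tape between rows: no tentative mark is pending and no end
  marker lies inside.\<close>

definition cells :: "nat list \<Rightarrow> bool" where
  "cells vs \<longleftrightarrow> set vs \<subseteq> {out, todo, marked}"

fun hits :: "bool list \<Rightarrow> nat list \<Rightarrow> nat" where
  "hits (r # row) (v # vs) = (if r \<and> v \<noteq> out then 1 else 0) + hits row vs"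
| "hits _ _ = 0"

definition mark :: "bool list \<Rightarrow> nat list \<Rightarrow> nat list" where
  "mark row vs = map2 (\<lambda>r v. if r \<and> v = todo then marked else v) row vs"

text \<open>With exactly one hit, \<open>mark\<close> changes at most one cell. The count is known
  here before any cell changes; the machine counts while it marks and therefore uses
  \<open>tentative\<close>.\<close>

definition update :: "bool list \<Rightarrow> nat list \<Rightarrow> nat list" where
  "update row vs = (if hits row vs = 1 then mark row vs else vs)"

text \<open>The recursion follows the unparsed word, as the machine reads it, so a truncated last
  row is rejected here too. The leading bit makes the word shrink even when \<open>vs\<close> is
  empty.\<close>

function check :: "nat list \<Rightarrow> bool list \<Rightarrow> bool" where
  "check vs [] \<longleftrightarrow> todo \<notin> set vs"
| "check vs (b # ws) \<longleftrightarrow> length vs \<le> length ws \<and>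
     \<not> (b \<and> hits (take (length vs) ws) vs > 0) \<and>
     check (update (take (length vs) ws) vs) (drop (length vs) ws)"
  by pat_completeness auto
termination by (relation "measure (\<lambda>(vs, ws). length ws)") auto

section \<open>Correctness of the recursive procedure\<close>

lemma hits_eq_card:
  "length row = length vs \<Longrightarrow> hits row vs = card {k. k < length vs \<and> row ! k \<and> vs ! k \<noteq> out}"
proof -
  assume len: "length row = length vs"
  then have "hits row vs = length (filter (\<lambda>(r, v). r \<and> v \<noteq> out) (zip row vs))"
    by (induction rule: list_induct2) auto
  also have "\<dots> = card {k. k < length vs \<and> row ! k \<and> vs ! k \<noteq> out}"
    using len by (auto simp: length_filter_conv_card intro!: arg_cong[of _ _ card])
  finally show ?thesis .
qed

lemma hits_eq_0_iff:
  "length row = length vs \<Longrightarrow> hits row vs = 0 \<longleftrightarrow> (\<forall>k<length vs. \<not> (row ! k \<and> vs ! k \<noteq> out))"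
  by (auto simp: hits_eq_card)

lemma hits_eq_1_iff:
  "length row = length vs \<Longrightarrow> hits row vs = 1 \<longleftrightarrow>
     (\<exists>k<length vs. \<forall>j<length vs. row ! j \<and> vs ! j \<noteq> out \<longleftrightarrow> j = k)"
  unfolding hits_eq_card One_nat_def card_1_singleton_iff by (auto simp: set_eq_iff)

lemma length_update [simp]: "length row = length vs \<Longrightarrow> length (update row vs) = length vs"
  by (simp add: update_def mark_def)

lemma nth_update:
  "length row = length vs \<Longrightarrow> k < length vs \<Longrightarrow>
     update row vs ! k = (if hits row vs = 1 \<and> row ! k \<and> vs ! k = todo then marked else vs ! k)"
  by (auto simp: update_def mark_def)

lemma cells_update: "length row = length vs \<Longrightarrow> cells vs \<Longrightarrow> cells (update row vs)"
  by (fastforce simp: cells_def nth_update in_set_conv_nth subset_iff)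

definition check_rows :: "nat list \<Rightarrow> (bool \<times> bool list) list \<Rightarrow> bool" where
  "check_rows vs rows \<longleftrightarrow>
     (\<forall>(b, r)\<in>set rows. b \<longrightarrow> (\<forall>k<length vs. \<not> (r ! k \<and> vs ! k \<noteq> out))) \<and>
     (\<forall>k<length vs. vs ! k = todo \<longrightarrow>
        (\<exists>(b, r)\<in>set rows. \<forall>j<length vs. r ! j \<and> vs ! j \<noteq> out \<longleftrightarrow> j = k))"

lemma check_rows_Cons:
  assumes len: "length r = length vs"
  shows "check_rows vs ((b, r) # rows) \<longleftrightarrow>
     \<not> (b \<and> hits r vs > 0) \<and> check_rows (update r vs) rows"
proof -
  define unhit where "unhit r' \<longleftrightarrow> (\<forall>k<length vs. \<not> (r' ! k \<and> vs ! k \<noteq> out))" for r'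
  define only_hit where "only_hit r' k \<longleftrightarrow> (\<forall>j<length vs. r' ! j \<and> vs ! j \<noteq> out \<longleftrightarrow> j = k)" for r' k
  have out: "update r vs ! k \<noteq> out \<longleftrightarrow> vs ! k \<noteq> out" if "k < length vs" for k
    using that len by (simp add: nth_update)
  have todo: "update r vs ! k = todo \<longleftrightarrow> vs ! k = todo \<and> \<not> only_hit r k" if "k < length vs" for k
  proof -
    have "hits r vs = 1 \<and> r ! k \<and> vs ! k \<noteq> out \<longleftrightarrow> only_hit r k"
      unfolding hits_eq_1_iff[OF len] only_hit_def using that by blast
    then show ?thesis using that len by (auto simp: nth_update)
  qed
  have vs: "check_rows vs rows' \<longleftrightarrow> (\<forall>(b, r)\<in>set rows'. b \<longrightarrow> unhit r) \<and>
      (\<forall>k<length vs. vs ! k = todo \<longrightarrow> (\<exists>(b, r)\<in>set rows'. only_hit r k))" for rows'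
    by (simp only: check_rows_def unhit_def only_hit_def)
  have "(\<forall>k<length vs. \<not> (r' ! k \<and> update r vs ! k \<noteq> out)) \<longleftrightarrow> unhit r'"
    and "(\<forall>j<length vs. r' ! j \<and> update r vs ! j \<noteq> out \<longleftrightarrow> j = k) \<longleftrightarrow> only_hit r' k" for r' k
    unfolding unhit_def only_hit_def using out by blast+
  then have upd: "check_rows (update r vs) rows \<longleftrightarrow> (\<forall>(b, r)\<in>set rows. b \<longrightarrow> unhit r) \<and>
      (\<forall>k<length vs. vs ! k = todo \<and> \<not> only_hit r k \<longrightarrow> (\<exists>(b, r)\<in>set rows. only_hit r k))"
    unfolding check_rows_def length_update[OF len] by (simp only: todo cong: imp_cong)
  have "hits r vs > 0 \<longleftrightarrow> \<not> unhit r"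
    unfolding unhit_def hits_eq_0_iff[OF len, symmetric] by simp
  then show ?thesis unfolding vs upd by auto
qed

text \<open>Rows have fixed length \<open>Suc (length vs)\<close>, so a word splits into rows in at
  most one way, and the induction peels off one row at a time.\<close>

lemma check_iff:
  "check vs ws \<longleftrightarrow> (\<exists>rows. ws = concat (map (\<lambda>(b, r). b # r) rows) \<and>
     (\<forall>(b, r)\<in>set rows. length r = length vs) \<and> check_rows vs rows)"
proof (induction vs ws rule: check.induct)
  case (1 vs)
  have "check_rows vs [] \<longleftrightarrow> todo \<notin> set vs" by (auto simp: check_rows_def in_set_conv_nth)
  moreover have "concat (map (\<lambda>(b, r). b # r) rows) = [] \<longleftrightarrow> rows = []"
    for rows :: "(bool \<times> bool list) list" by (cases rows) auto
  ultimately show ?case by (auto dest: sym)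
next
  case (2 vs b ws)
  let ?n = "length vs"
  show ?case
  proof
    assume c: "check vs (b # ws)"
    then have len: "length (take ?n ws) = ?n" by simp
    from c 2 obtain rows where rows: "drop ?n ws = concat (map (\<lambda>(b, r). b # r) rows)"
      "\<forall>(b, r)\<in>set rows. length r = length (update (take ?n ws) vs)"
      "check_rows (update (take ?n ws) vs) rows" by auto
    have "b # ws = concat (map (\<lambda>(b, r). b # r) ((b, take ?n ws) # rows))"
      using rows(1) by (simp flip: rows(1))
    moreover have "check_rows vs ((b, take ?n ws) # rows)"
      using c rows(3) by (simp add: check_rows_Cons[OF len])
    moreover have "\<forall>(b, r)\<in>set ((b, take ?n ws) # rows). length r = ?n"
      using rows(2) len unfolding length_update[OF len] by auto
    ultimately show "\<exists>rows. b # ws = concat (map (\<lambda>(b, r). b # r) rows) \<and>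
      (\<forall>(b, r)\<in>set rows. length r = ?n) \<and> check_rows vs rows" by blast
  next
    assume "\<exists>rows. b # ws = concat (map (\<lambda>(b, r). b # r) rows) \<and>
      (\<forall>(b, r)\<in>set rows. length r = ?n) \<and> check_rows vs rows"
    then obtain rows where rows: "b # ws = concat (map (\<lambda>(b, r). b # r) rows)"
      "\<forall>(b, r)\<in>set rows. length r = ?n" "check_rows vs rows" by blast
    then obtain r rows' where eq: "rows = (b, r) # rows'"
      "ws = r @ concat (map (\<lambda>(b, r). b # r) rows')" by (cases rows) auto
    then have len: "length r = ?n" using rows(2) by auto
    then have tk: "take ?n ws = r" "drop ?n ws = concat (map (\<lambda>(b, r). b # r) rows')"
      using eq by auto
    have "check (update r vs) (drop ?n ws)"
      using 2 rows eq(1) len tk by (auto simp: check_rows_Cons)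
    then show "check vs (b # ws)"
      using rows(3) eq len tk by (simp add: check_rows_Cons)
  qed
qed

section \<open>Membership in the language\<close>

definition initial_cells :: "bool list \<Rightarrow> nat list" where
  "initial_cells u = map (\<lambda>b. if b then todo else out) u"

lemma extendable_iff_check_rows: "extendable u rows \<longleftrightarrow> check_rows (initial_cells u) rows"
proof -
  have "initial_cells u ! k \<noteq> out \<longleftrightarrow> u ! k" "initial_cells u ! k = todo \<longleftrightarrow> u ! k"
    if "k < length u" for k
    using that by (auto simp: initial_cells_def)
  moreover have "length (initial_cells u) = length u" by (simp add: initial_cells_def)
  ultimately show ?thesis
    unfolding extendable_def check_rows_def by (simp cong: conj_cong)
qed

text \<open>The unary prefix fixes the number of vertices, hence where the characteristic vector
  ends and the rows begin.\<close>

lemma mem_ext_rhs_language_iff: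
  "replicate n True @ False # ws \<in> ext_rhs_language \<longleftrightarrow>
     n \<le> length ws \<and> check (initial_cells (take n ws)) (drop n ws)"
proof
  assume "replicate n True @ False # ws \<in> ext_rhs_language"
  then obtain u rows where w: "replicate n True @ False # ws = word_of u rows"
    and r: "\<forall>(b, r)\<in>set rows. length r = length u" "extendable u rows"
    unfolding ext_rhs_language_eq by blast
  then have "n = length u" "ws = u @ concat (map (\<lambda>(b, r). b # r) rows)"
    using replicate_True_False_inject unfolding word_of_def by blast+
  then show "n \<le> length ws \<and> check (initial_cells (take n ws)) (drop n ws)"
    using r unfolding check_iff extendable_iff_check_rows
    by (auto simp: initial_cells_def intro!: exI[of _ rows])
next
  assume a: "n \<le> length ws \<and> check (initial_cells (take n ws)) (drop n ws)"
  then obtain rows where rows: "drop n ws = concat (map (\<lambda>(b, r). b # r) rows)"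
    "\<forall>(b, r)\<in>set rows. length r = length (take n ws)" "extendable (take n ws) rows"
    unfolding check_iff extendable_iff_check_rows by (auto simp: initial_cells_def)
  have "replicate n True @ False # ws = word_of (take n ws) rows"
    using a by (simp add: word_of_def flip: rows(1))
  then show "replicate n True @ False # ws \<in> ext_rhs_language"
    unfolding ext_rhs_language_eq using rows by blast
qed

lemma replicate_True_notin_ext_rhs_language: "replicate n True \<notin> ext_rhs_language"
proof -
  have "False \<in> set w" if "w \<in> ext_rhs_language" for w
    using that by (auto simp: ext_rhs_language_eq word_of_def)
  from this[of "replicate n True"] show ?thesis by auto
qed

section \<open>The machine\<close>

abbreviation (input) "q_start \<equiv> 0 :: nat"
abbreviation (input) "q_unary \<equiv> 3 :: nat"
abbreviation (input) "q_load \<equiv> 4 :: nat"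
abbreviation (input) "q_undo \<equiv> 5 :: nat"
abbreviation (input) "q_row \<equiv> 6 :: nat"
abbreviation (input) "q_forbid \<equiv> 7 :: nat"
abbreviation (input) "q_none \<equiv> 8 :: nat"
abbreviation (input) "q_one \<equiv> 9 :: nat"
abbreviation (input) "q_commit \<equiv> 10 :: nat"
abbreviation (input) "q_many \<equiv> 11 :: nat"
abbreviation (input) "q_final \<equiv> 12 :: nat"

text \<open>The result consists of the new state, the move on the input tape (whose contents never
  change), and the symbol written and the move on the second tape. The unary part of the input is
  copied to the second tape from right to left, so that afterwards its head is at the left end.
  The states \<open>q_none\<close>, \<open>q_one\<close>, \<open>q_many\<close> count the hits in a row whose index is not in \<open>U\<^sub>1\<close>.\<close>

definition transition :: "nat \<Rightarrow> nat \<Rightarrow> nat \<Rightarrow> nat \<times> direction \<times> nat \<times> direction" where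
  "transition q a b =
    (let reject = (reject_state, Stay, b, Stay) in
     if q = q_start then (q_unary, Stay, end_marker, Go_Left)
     else if q = q_unary then
       if a = 2 then (q_unary, Go_Right, out, Go_Left)
       else if a = 1 then (q_load, Go_Right, end_marker, Go_Right)
       else reject
     else if q = q_load then
       if b = end_marker then (q_undo, Stay, b, Go_Left)
       else if a = 0 then reject
       else (q_load, Go_Right, if a = 2 then todo else out, Go_Right)
     else if q = q_undo then
       if b = end_marker then (q_row, Stay, b, Go_Right)
       else (q_undo, Stay, if b = tentative then todo else b, Go_Left)
     else if q = q_commit then
       if b = end_marker then (q_row, Stay, b, Go_Right)
       else (q_commit, Stay, if b = tentative then marked else b, Go_Left)
     else if q = q_row then
       if a = 0 then (q_final, Stay, b, Stay)
       else (if a = 2 then q_forbid else q_none, Go_Right, b, Stay)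
     else if q = q_forbid then
       if b = end_marker then (q_undo, Stay, b, Go_Left)
       else if a = 0 \<or> a = 2 \<and> b \<noteq> out then reject
       else (q_forbid, Go_Right, b, Go_Right)
     else if q = q_none then
       if b = end_marker then (q_undo, Stay, b, Go_Left)
       else if a = 0 then reject
       else if a = 2 \<and> b \<noteq> out
         then (q_one, Go_Right, if b = todo then tentative else b, Go_Right)
       else (q_none, Go_Right, b, Go_Right)
     else if q = q_one then
       if b = end_marker then (q_commit, Stay, b, Go_Left)
       else if a = 0 then reject
       else (if a = 2 \<and> b \<noteq> out then q_many else q_one, Go_Right, b, Go_Right)
     else if q = q_many then
       if b = end_marker then (q_undo, Stay, b, Go_Left)
       else if a = 0 then reject
       else (q_many, Go_Right, b, Go_Right)
     else if q = q_final then
       if b = end_marker then (accept_state, Stay, b, Stay)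
       else if b = todo then reject
       else (q_final, Stay, b, Go_Right)
     else reject)"

definition machine :: tm where
  "machine = \<lparr>num_tapes = 2, num_states = 13, num_symbols = 6,
     delta = (\<lambda>q ss. case transition q (ss ! 0) (ss ! 1) of
       (q', d, s, d') \<Rightarrow> (q', [(ss ! 0, d), (s, d')]))\<rparr>"

lemma transition_bounds:
  assumes "b < 6" and "transition q a b = (q', d, s, d')"
  shows "q' < 13" and "s < 6"
  using assms
  by (auto simp: transition_def Let_def accept_state_def reject_state_def split: if_splits)

text \<open>The input is read once from left to right, so a list configuration can describe the
  first tape by the unread suffix alone.\<close>

lemma transition_not_Go_Left: "transition q a b = (q', d, s, d') \<Longrightarrow> d \<noteq> Go_Left"
  by (auto simp: transition_def Let_def split: if_splits)

lemma is_tm_machine: "is_tm machine"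
proof -
  have "case delta machine q ss of (q', acts) \<Rightarrow>
      q' < 13 \<and> length acts = 2 \<and> (\<forall>(s, d)\<in>set acts. s < 6)"
    if "length ss = 2" "\<forall>s\<in>set ss. s < 6" for q ss
  proof -
    have "ss ! 0 < 6" "ss ! 1 < 6" using that by auto
    then show ?thesis
      using transition_bounds[of "ss ! 1" q "ss ! 0"]
      by (cases "transition q (ss ! 0) (ss ! 1)") (auto simp: machine_def)
  qed
  then show ?thesis by (auto simp: is_tm_def machine_def)
qed

subsection \<open>Configurations as lists\<close>

text \<open>The default 0 is the blank: an empty list stands for a blank half-tape.\<close>

fun head_symbol :: "nat list \<Rightarrow> nat" where
  "head_symbol [] = 0"
| "head_symbol (s # _) = s"

fun bit_symbol :: "bool \<Rightarrow> nat" where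
  "bit_symbol True = 2"
| "bit_symbol False = 1"

fun write_move :: "nat \<Rightarrow> direction \<Rightarrow> nat list \<Rightarrow> nat list \<Rightarrow> nat list \<times> nat list" where
  "write_move s Go_Left ls rs = (tl ls, head_symbol ls # s # tl rs)"
| "write_move s Stay ls rs = (ls, s # tl rs)"
| "write_move s Go_Right ls rs = (s # ls, tl rs)"

type_synonym list_config = "nat \<times> bool list \<times> nat list \<times> nat list"

text \<open>A list configuration has the unread input, the second tape to the left of the head
  (nearest cell first), and the second tape from the head onwards.\<close>

fun list_step :: "list_config \<Rightarrow> list_config" where
  "list_step (q, ws, ls, rs) =
     (if q = accept_state \<or> q = reject_state then (q, ws, ls, rs)
      else case transition q (head_symbol (map bit_symbol ws)) (head_symbol rs) of (q', d, s, d') \<Rightarrow>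
        (q', if d = Go_Right then tl ws else ws, write_move s d' ls rs))"

section \<open>Half-tapes as lists, and the simulation\<close>

definition right_part :: "tape \<Rightarrow> nat list \<Rightarrow> bool" where
  "right_part t rs \<longleftrightarrow> (\<forall>k. snd t (fst t + int k) = (if k < length rs then rs ! k else 0))"

text \<open>Both predicates pad the list with blanks, so a half-tape has many lists and trailing
  blanks do no harm.\<close>

definition left_part :: "tape \<Rightarrow> nat list \<Rightarrow> bool" where
  "left_part t ls \<longleftrightarrow> (\<forall>k. snd t (fst t - 1 - int k) = (if k < length ls then ls ! k else 0))"

lemma read_tape_right_part: "right_part t rs \<Longrightarrow> read_tape t = head_symbol rs"
  by (cases t; cases rs) (auto simp: right_part_def dest!: spec[of _ 0])

lemma right_part_tl: "right_part (h, c) rs \<Longrightarrow> right_part (h + 1, c(h := s)) (tl rs)"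
  unfolding right_part_def
proof (intro allI)
  fix k assume "\<forall>k. snd (h, c) (fst (h, c) + int k) = (if k < length rs then rs ! k else 0)"
  from spec[OF this, of "Suc k"]
  show "snd (h + 1, c(h := s)) (fst (h + 1, c(h := s)) + int k) =
      (if k < length (tl rs) then tl rs ! k else 0)"
    by (cases rs) (auto simp: add_ac)
qed

lemma right_part_write: "right_part (h, c) rs \<Longrightarrow> right_part (h, c(h := s)) (s # tl rs)"
  unfolding right_part_def
proof (intro allI)
  fix k assume "\<forall>k. snd (h, c) (fst (h, c) + int k) = (if k < length rs then rs ! k else 0)"
  from spec[OF this, of k]
  show "snd (h, c(h := s)) (fst (h, c(h := s)) + int k) =
      (if k < length (s # tl rs) then (s # tl rs) ! k else 0)"
    by (cases rs; cases k) auto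
qed

lemma right_part_Go_Left:
  assumes "left_part (h, c) ls" and "right_part (h, c) rs"
  shows "right_part (h - 1, c) (head_symbol ls # rs)"
  unfolding right_part_def
proof
  fix k
  show "snd (h - 1, c) (fst (h - 1, c) + int k) =
      (if k < length (head_symbol ls # rs) then (head_symbol ls # rs) ! k else 0)"
  proof (cases k)
    case 0
    have "c (h - 1) = head_symbol ls"
      using assms(1) by (cases ls) (auto simp: left_part_def dest!: spec[of _ 0])
    then show ?thesis using 0 by simp
  next
    case (Suc j)
    then show ?thesis using assms(2) by (auto simp: right_part_def dest!: spec[of _ j])
  qed
qed

lemma left_part_Go_Left: "left_part (h, c) ls \<Longrightarrow> left_part (h - 1, c) (tl ls)"
  unfolding left_part_def
proof (intro allI)
  fix k assume "\<forall>k. snd (h, c) (fst (h, c) - 1 - int k) = (if k < length ls then ls ! k else 0)"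
  from spec[OF this, of "Suc k"]
  show "snd (h - 1, c) (fst (h - 1, c) - 1 - int k) =
      (if k < length (tl ls) then tl ls ! k else 0)"
    by (cases ls) (auto simp: algebra_simps)
qed

lemma left_part_Go_Right: "left_part (h, c) ls \<Longrightarrow> left_part (h + 1, c(h := s)) (s # ls)"
  unfolding left_part_def
proof (intro allI)
  fix k assume "\<forall>k. snd (h, c) (fst (h, c) - 1 - int k) = (if k < length ls then ls ! k else 0)"
  from spec[OF this, of "k - 1"]
  show "snd (h + 1, c(h := s)) (fst (h + 1, c(h := s)) - 1 - int k) =
      (if k < length (s # ls) then (s # ls) ! k else 0)"
    by (cases k) (auto simp: algebra_simps)
qed

lemma left_part_write: "left_part (h, c) ls \<Longrightarrow> left_part (h, c(h := s)) ls"
  by (simp add: left_part_def)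

lemma act_tape_parts:
  assumes "left_part t ls" and "right_part t rs" and "write_move s d ls rs = (ls', rs')"
  shows "left_part (act_tape (s, d) t) ls'" and "right_part (act_tape (s, d) t) rs'"
  using assms
  by (cases t; cases d;
      auto intro: left_part_Go_Left left_part_Go_Right left_part_write right_part_tl
        right_part_write right_part_Go_Left)+

fun represents :: "config \<Rightarrow> list_config \<Rightarrow> bool" where
  "represents C (q, ws, ls, rs) \<longleftrightarrow> (\<exists>t t'. C = (q, [t, t']) \<and>
     right_part t (map bit_symbol ws) \<and> left_part t' ls \<and> right_part t' rs)"

text \<open>The simulation is in lockstep, so step counts for list configurations are step counts
  for the machine.\<close>

lemma represents_step:
  assumes "represents C A"
  shows "represents (step machine C) (list_step A)"
proof -
  obtain q ws ls rs where A: "A = (q, ws, ls, rs)" by (cases A)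
  then obtain t t' where C: "C = (q, [t, t'])" and t: "right_part t (map bit_symbol ws)"
    and t': "left_part t' ls" "right_part t' rs" using assms by auto
  show ?thesis
  proof (cases "q = accept_state \<or> q = reject_state")
    case True
    then show ?thesis using A C t t' by auto
  next
    case False
    obtain q' d s d' where tr:
      "transition q (head_symbol (map bit_symbol ws)) (head_symbol rs) = (q', d, s, d')"
      by (cases "transition q (head_symbol (map bit_symbol ws)) (head_symbol rs)")
    obtain ls' rs' where wm: "write_move s d' ls rs = (ls', rs')" by fastforce
    have rd: "read_tape t = head_symbol (map bit_symbol ws)" "read_tape t' = head_symbol rs"
      using t t' by (auto intro: read_tape_right_part)
    have "step machine C = (q', [act_tape (read_tape t, d) t, act_tape (s, d') t'])"
      using False by (simp add: C machine_def rd tr)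
    moreover have "list_step A = (q', if d = Go_Right then tl ws else ws, ls', rs')"
      using False by (simp add: A tr wm)
    \<comment> \<open>The first tape gets back the symbol just read, so only a move to the right
      changes the part from the head onwards.\<close>
    moreover have "right_part (act_tape (read_tape t, d) t)
        (map bit_symbol (if d = Go_Right then tl ws else ws))"
    proof (cases t)
      case (Pair h c)
      then show ?thesis
        using t transition_not_Go_Left[OF tr] right_part_tl[of h c "map bit_symbol ws" "c h"]
        by (cases d) (auto simp: map_tl)
    qed
    ultimately show ?thesis using act_tape_parts[OF t' wm] by auto
  qed
qed

lemma represents_initial: "represents (initial_config machine w) (q_start, w, [], [])"
proof -
  have "right_part (input_tape w) (map bit_symbol w)"
    by (auto simp: right_part_def input_tape_def)
  moreover have "left_part blank_tape []" "right_part blank_tape []"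
    by (auto simp: left_part_def right_part_def blank_tape_def)
  moreover have "initial_config machine w = (q_start, [input_tape w, blank_tape])"
    by (simp add: initial_config_def machine_def)
  ultimately show ?thesis by auto
qed

section \<open>Halting within a time bound\<close>

definition halts :: "nat \<Rightarrow> list_config \<Rightarrow> bool \<Rightarrow> bool" where
  "halts n A result \<longleftrightarrow>
     (\<exists>t\<le>n. fst ((list_step ^^ t) A) = (if result then accept_state else reject_state))"

lemma halts_mono: "halts m A b \<Longrightarrow> m \<le> n \<Longrightarrow> halts n A b"
  unfolding halts_def using order_trans by blast

text \<open>Runs are assembled backwards with this rule: most lemmas on runs assume a bound for the
  rest of the run and put one phase in front of it.\<close>

lemma halts_step:
  assumes "halts n (list_step A) b"
  shows "halts (Suc n) A b"
proof -
  obtain t where "t \<le> n"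
    "fst ((list_step ^^ t) (list_step A)) = (if b then accept_state else reject_state)"
    using assms by (auto simp: halts_def)
  then show ?thesis
    unfolding halts_def by (intro exI[of _ "Suc t"]) (auto simp: funpow_swap1)
qed

lemma halts_rejecting: "halts n (reject_state, A) False"
  by (auto simp: halts_def intro!: exI[of _ 0])

lemma halts_accepting: "halts n (accept_state, A) True"
  by (auto simp: halts_def intro!: exI[of _ 0])

lemma decides_in_time_machine:
  assumes "\<And>w. halts (T (length w)) (q_start, w, [], []) (w \<in> L)"
  shows "decides_in_time machine L T"
  unfolding decides_in_time_def
proof
  fix w
  obtain t where t: "t \<le> T (length w)"
    "fst ((list_step ^^ t) (q_start, w, [], [])) = (if w \<in> L then accept_state else reject_state)"
    using assms[of w] by (auto simp: halts_def)
  have "represents ((step machine ^^ t) (initial_config machine w))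
      ((list_step ^^ t) (q_start, w, [], []))"
    by (induction t) (auto simp del: represents.simps list_step.simps intro: represents_initial represents_step)
  then have "fst ((step machine ^^ t) (initial_config machine w)) =
      fst ((list_step ^^ t) (q_start, w, [], []))"
    by (cases "(list_step ^^ t) (q_start, w, [], [])") auto
  then show "\<exists>t\<le>T (length w). fst ((step machine ^^ t) (initial_config machine w)) =
      (if w \<in> L then accept_state else reject_state)"
    using t by auto
qed

subsection \<open>Runs of the machine\<close>

lemmas run_simps = transition_def Let_def accept_state_def reject_state_def

lemma bit_symbol_eq_iff [simp]:
  "bit_symbol r \<noteq> 0" "bit_symbol r = 2 \<longleftrightarrow> r" "bit_symbol r = 1 \<longleftrightarrow> \<not> r"
  "bit_symbol r = Suc 0 \<longleftrightarrow> \<not> r"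
  by (cases r; simp)+

section \<open>Return to the left end marker\<close>

abbreviation (input) "undo v \<equiv> (if v = tentative then todo else v)"
abbreviation (input) "commit v \<equiv> (if v = tentative then marked else v)"

text \<open>The use of \<open>tl\<close> and \<open>head_symbol\<close> describes the moment just
  after a step to the left, also for empty \<open>ls\<close>, when the head is already on the
  marker. The extra step turns round at the marker.\<close>

lemma halts_undo:
  assumes "end_marker \<notin> set ls"
    and "halts n (q_row, ws, [end_marker], map undo (rev ls) @ rs) b"
  shows "halts (n + length ls + 1)
    (q_undo, ws, tl (ls @ [end_marker]), head_symbol (ls @ [end_marker]) # rs) b"
  using assms
proof (induction ls arbitrary: rs)
  case Nil
  then show ?case by (auto intro!: halts_step simp: run_simps)
next
  case (Cons v ls)
  then have "halts (n + length ls + 1)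
    (q_undo, ws, tl (ls @ [end_marker]), head_symbol (ls @ [end_marker]) # undo v # rs) b"
    by simp
  then have "halts (n + length ls + 1) (list_step (q_undo, ws, ls @ [end_marker], v # rs)) b"
    using Cons.prems(1) by (simp add: run_simps)
  from halts_step[OF this] show ?case by simp
qed

lemma halts_commit:
  assumes "end_marker \<notin> set ls"
    and "halts n (q_row, ws, [end_marker], map commit (rev ls) @ rs) b"
  shows "halts (n + length ls + 1)
    (q_commit, ws, tl (ls @ [end_marker]), head_symbol (ls @ [end_marker]) # rs) b"
  using assms
proof (induction ls arbitrary: rs)
  case Nil
  then show ?case by (auto intro!: halts_step simp: run_simps)
next
  case (Cons v ls)
  then have "halts (n + length ls + 1)
    (q_commit, ws, tl (ls @ [end_marker]), head_symbol (ls @ [end_marker]) # commit v # rs) b"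
    by simp
  then have "halts (n + length ls + 1) (list_step (q_commit, ws, ls @ [end_marker], v # rs)) b"
    using Cons.prems(1) by (simp add: run_simps)
  from halts_step[OF this] show ?case by simp
qed

text \<open>These are the states that start an undoing sweep at the right end marker. One step turns
  there and one at the left end.\<close>

lemma halts_turn_undo:
  assumes "q \<in> {q_load, q_forbid, q_none, q_many}" and "end_marker \<notin> set vs"
    and "halts n (q_row, ws, [end_marker], map undo vs @ [end_marker]) b"
  shows "halts (n + length vs + 2) (q, ws, rev vs @ [end_marker], [end_marker]) b"
proof -
  have "list_step (q, ws, rev vs @ [end_marker], [end_marker]) =
    (q_undo, ws, tl (rev vs @ [end_marker]), [head_symbol (rev vs @ [end_marker]), end_marker])"
    using assms(1) by (auto simp: run_simps)
  then have "halts (n + length vs + 1)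
    (list_step (q, ws, rev vs @ [end_marker], [end_marker])) b"
    using halts_undo[of "rev vs" n ws "[end_marker]" b] assms(2,3) by (simp del: list_step.simps)
  from halts_step[OF this] show ?thesis by simp
qed

lemma halts_turn_commit:
  assumes "end_marker \<notin> set vs"
    and "halts n (q_row, ws, [end_marker], map commit vs @ [end_marker]) b"
  shows "halts (n + length vs + 2) (q_one, ws, rev vs @ [end_marker], [end_marker]) b"
proof -
  have "list_step (q_one, ws, rev vs @ [end_marker], [end_marker]) =
    (q_commit, ws, tl (rev vs @ [end_marker]), [head_symbol (rev vs @ [end_marker]), end_marker])"
    by (auto simp: run_simps)
  then have "halts (n + length vs + 1)
    (list_step (q_one, ws, rev vs @ [end_marker], [end_marker])) b"
    using halts_commit[of "rev vs" n ws "[end_marker]" b] assms by (simp del: list_step.simps)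
  from halts_step[OF this] show ?thesis by simp
qed

section \<open>Scanning one row\<close>

lemma halts_many:
  assumes "length row = length vs" and "cells vs"
    and "halts n (q_many, ws, rev vs @ ls, rs) b"
  shows "halts (n + length vs) (q_many, row @ ws, ls, vs @ rs) b"
  using assms
proof (induction row vs arbitrary: ls rule: list_induct2)
  case (Cons r row v vs)
  then have "halts (n + length vs) (q_many, row @ ws, v # ls, vs @ rs) b"
    by (simp add: cells_def)
  then have "halts (n + length vs) (list_step (q_many, (r # row) @ ws, ls, (v # vs) @ rs)) b"
    using Cons.prems(1) by (auto simp: run_simps cells_def)
  from halts_step[OF this] show ?case by simp
qed simp

text \<open>Here \<open>row\<close> and \<open>vs\<close> are what is left after the first hit, so
  any further hit leads to \<open>q_many\<close>.\<close>

lemma halts_one: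
  assumes "length row = length vs" and "cells vs"
    and "halts n (if hits row vs = 0 then q_one else q_many, ws, rev vs @ ls, rs) b"
  shows "halts (n + length vs) (q_one, row @ ws, ls, vs @ rs) b"
  using assms
proof (induction row vs arbitrary: ls rule: list_induct2)
  case (Cons r row v vs)
  have "halts (n + length vs) (if r \<and> v \<noteq> out then q_many else q_one, row @ ws, v # ls, vs @ rs) b"
  proof (cases "r \<and> v \<noteq> out")
    case True
    then show ?thesis
      using Cons.prems Cons.hyps halts_many[of row vs n ws "v # ls"] by (simp add: cells_def)
  next
    case False
    then show ?thesis using Cons.prems Cons.IH[of "v # ls"]
      by (auto simp: cells_def split: if_splits)
  qed
  then have "halts (n + length vs) (list_step (q_one, (r # row) @ ws, ls, (v # vs) @ rs)) b"
    using Cons.prems(1) by (auto simp: run_simps cells_def split: if_splits)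
  from halts_step[OF this] show ?case by simp
qed simp

lemma mark_no_hits: "length row = length vs \<Longrightarrow> hits row vs = 0 \<Longrightarrow> mark row vs = vs"
  by (induction row vs rule: list_induct2) (auto simp: mark_def split: if_splits)

text \<open>The scanned tape \<open>vs'\<close> may carry one tentative mark; it is specified only
  through the sweep that follows, \<open>commit\<close> for exactly one hit and \<open>undo\<close>
  otherwise. Both witnesses precede \<open>n\<close> and \<open>ls\<close>, so that the induction
  can push further cells onto \<open>ls\<close>.\<close>

lemma halts_none:
  assumes "length row = length vs" and "cells vs"
  shows "\<exists>q vs'. length vs' = length vs \<and> end_marker \<notin> set vs' \<and>
    (if hits row vs = 1 then q = q_one \<and> map commit vs' = mark row vs
     else q \<in> {q_none, q_many} \<and> map undo vs' = vs) \<and>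
    (\<forall>n ls. halts n (q, ws, rev vs' @ ls, rs) b \<longrightarrow>
       halts (n + length vs) (q_none, row @ ws, ls, vs @ rs) b)"
  using assms
proof (induction row vs rule: list_induct2)
  case Nil
  then show ?case by (intro exI[of _ q_none] exI[of _ "[]"]) auto
next
  case (Cons r row v vs)
  have v: "v \<in> {out, todo, marked}" and vs: "cells vs" using Cons.prems by (auto simp: cells_def)
  have clean: "end_marker \<notin> set vs" "map commit vs = vs" "map undo vs = vs"
    using vs by (auto simp: cells_def intro!: map_idI)
  show ?case
  proof (cases "r \<and> v \<noteq> out")
    case True
    define q where "q = (if hits row vs = 0 then q_one else q_many)"
    \<comment> \<open>A first hit on a \<open>marked\<close> cell is counted but leaves the cell
      alone; \<open>commit\<close> yields \<open>marked\<close> in either case.\<close>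
    define v' where "v' = (if v = todo then tentative else v)"
    have v': "v' \<noteq> end_marker" "commit v' = marked" "undo v' = v"
      using v True by (auto simp: v'_def)
    have "halts (n + length (v # vs)) (q_none, (r # row) @ ws, ls, (v # vs) @ rs) b"
      if "halts n (q, ws, rev (v' # vs) @ ls, rs) b" for n ls
    proof -
      have "halts (n + length vs) (q_one, row @ ws, v' # ls, vs @ rs) b"
        using that Cons.hyps vs by (intro halts_one) (simp_all add: q_def)
      then have "halts (n + length vs) (list_step (q_none, (r # row) @ ws, ls, (v # vs) @ rs)) b"
        using v True by (auto simp: run_simps v'_def)
      from halts_step[OF this] show ?thesis by simp
    qed
    moreover have "mark (r # row) (v # vs) = marked # mark row vs"
      using v True by (auto simp: mark_def)
    ultimately show ?thesis
      using True v' clean mark_no_hits[OF Cons.hyps]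
      by (intro exI[of _ q] exI[of _ "v' # vs"]) (auto simp: q_def)
  next
    case False
    obtain q vs' where IH: "length vs' = length vs" "end_marker \<notin> set vs'"
      "if hits row vs = 1 then q = q_one \<and> map commit vs' = mark row vs
       else q \<in> {q_none, q_many} \<and> map undo vs' = vs"
      "\<And>n ls. halts n (q, ws, rev vs' @ ls, rs) b \<Longrightarrow>
         halts (n + length vs) (q_none, row @ ws, ls, vs @ rs) b"
      using Cons.IH[OF vs] by blast
    have run: "halts (n + length (v # vs)) (q_none, (r # row) @ ws, ls, (v # vs) @ rs) b"
      if "halts n (q, ws, rev (v # vs') @ ls, rs) b" for n ls
    proof -
      have "halts (n + length vs) (q_none, row @ ws, v # ls, vs @ rs) b"
        using that by (intro IH(4)) simp
      then have "halts (n + length vs) (list_step (q_none, (r # row) @ ws, ls, (v # vs) @ rs)) b"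
        using v False by (auto simp: run_simps)
      from halts_step[OF this] show ?thesis by simp
    qed
    have "mark (r # row) (v # vs) = v # mark row vs" "hits (r # row) (v # vs) = hits row vs"
      using False by (auto simp: mark_def)
    then have "if hits (r # row) (v # vs) = 1
      then q = q_one \<and> map commit (v # vs') = mark (r # row) (v # vs)
      else q \<in> {q_none, q_many} \<and> map undo (v # vs') = v # vs"
      using IH(3) v by (simp only: list.map split: if_splits) auto
    moreover have "length (v # vs') = length (v # vs)" "end_marker \<notin> set (v # vs')"
      using IH(1,2) v by auto
    ultimately show ?thesis using run by (intro exI[of _ q] exI[of _ "v # vs'"] conjI allI impI)
  qed
qed

lemma halts_forbid:
  assumes "length row = length vs" and "cells vs"
    and "hits row vs = 0 \<Longrightarrow> halts n (q_forbid, ws, rev vs @ ls, rs) b"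
    and "hits row vs > 0 \<Longrightarrow> \<not> b"
  shows "halts (n + length vs) (q_forbid, row @ ws, ls, vs @ rs) b"
  using assms
proof (induction row vs arbitrary: ls rule: list_induct2)
  case (Cons r row v vs)
  have "halts (n + length vs) (list_step (q_forbid, (r # row) @ ws, ls, (v # vs) @ rs)) b"
  proof (cases "r \<and> v \<noteq> out")
    case True
    then have "list_step (q_forbid, (r # row) @ ws, ls, (v # vs) @ rs) =
        (reject_state, (r # row) @ ws, ls, (v # vs) @ rs)"
      using Cons.prems(1) by (auto simp: run_simps cells_def)
    moreover have "b = False" using True Cons.prems(3) by auto
    ultimately show ?thesis using halts_rejecting by (simp del: list_step.simps)
  next
    case False
    then have "halts (n + length vs) (q_forbid, row @ ws, v # ls, vs @ rs) b"
      using Cons.prems by (intro Cons.IH) (auto simp: cells_def)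
    then show ?thesis using False Cons.prems(1) by (auto simp: run_simps cells_def)
  qed
  from halts_step[OF this] show ?case by simp
qed simp

text \<open>The cost is one step for the leading bit, \<open>length vs\<close> for the scan and
  \<open>length vs + 2\<close> for the return.\<close>

lemma halts_row:
  assumes len: "length row = length vs" and vs: "cells vs"
    and forbidden: "b \<Longrightarrow> hits row vs > 0 \<Longrightarrow> \<not> result"
    and go: "\<not> (b \<and> hits row vs > 0) \<Longrightarrow>
      halts n (q_row, ws, [end_marker], update row vs @ [end_marker]) result"
  shows "halts (n + 2 * length vs + 3)
    (q_row, b # row @ ws, [end_marker], vs @ [end_marker]) result"
proof -
  have clean: "end_marker \<notin> set vs" "map undo vs = vs"
    using vs by (auto simp: cells_def intro!: map_idI)
  have "halts ((n + length vs + 2) + length vs)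
    (if b then q_forbid else q_none, row @ ws, [end_marker], vs @ [end_marker]) result"
  proof (cases b)
    case True
    have "halts (n + length vs + 2) (q_forbid, ws, rev vs @ [end_marker], [end_marker]) result"
      if "hits row vs = 0"
      using that clean go by (intro halts_turn_undo) (auto simp: update_def)
    then show ?thesis
      using True len vs forbidden halts_forbid[of row vs "n + length vs + 2"] by simp
  next
    case False
    obtain q vs' where q: "length vs' = length vs" "end_marker \<notin> set vs'"
      "if hits row vs = 1 then q = q_one \<and> map commit vs' = mark row vs
       else q \<in> {q_none, q_many} \<and> map undo vs' = vs"
      "\<And>n ls. halts n (q, ws, rev vs' @ ls, [end_marker]) result \<Longrightarrow>
         halts (n + length vs) (q_none, row @ ws, ls, vs @ [end_marker]) result"
      using halts_none[OF len vs] by blast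
    have "halts (n + length vs' + 2) (q, ws, rev vs' @ [end_marker], [end_marker]) result"
    proof (cases "hits row vs = 1")
      case True
      then show ?thesis
        using q(2,3) go False halts_turn_commit[of vs' n ws] by (simp add: update_def)
    next
      case F: False
      then show ?thesis
        using q(2,3) go False by (intro halts_turn_undo) (auto simp: update_def)
    qed
    then show ?thesis using False q(1) q(4)[of "n + length vs + 2" "[end_marker]"] by simp
  qed
  then have "halts ((n + length vs + 2) + length vs)
    (list_step (q_row, b # row @ ws, [end_marker], vs @ [end_marker])) result"
    \<comment> \<open>The case split shows that writing back the symbol under the second head leaves
      the list as it was.\<close>
    by (cases vs) (auto simp: run_simps)
  from halts_step[OF this] show ?thesis by (rule halts_mono) simp
qed

text \<open>In every scanning state a step either consumes one bit and one cell or rejects, so the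
  input runs out before the end marker is reached.\<close>

lemma halts_short:
  assumes "length ws < length vs" and "cells vs"
    and "q \<in> {q_load, q_forbid, q_none, q_one, q_many}"
  shows "halts (length ws + 1) (q, ws, ls, vs @ rs) False"
  using assms
proof (induction ws arbitrary: q ls vs)
  case Nil
  then obtain v vs' where "vs = v # vs'" "v \<noteq> end_marker" by (cases vs) (auto simp: cells_def)
  then have "list_step (q, [], ls, vs @ rs) = (reject_state, [], ls, vs @ rs)"
    using Nil.prems(3) by (auto simp: run_simps)
  then show ?case using halts_step[of 0] halts_rejecting by simp
next
  case (Cons r ws)
  then obtain v vs' where vs: "vs = v # vs'" "v \<noteq> end_marker" "length ws < length vs'" "cells vs'"
    by (cases vs) (auto simp: cells_def)
  have "(\<exists>q' ls'. q' \<in> {q_load, q_forbid, q_none, q_one, q_many} \<and>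
      list_step (q, r # ws, ls, vs @ rs) = (q', ws, ls', vs' @ rs)) \<or>
    list_step (q, r # ws, ls, vs @ rs) = (reject_state, r # ws, ls, vs @ rs)"
    using Cons.prems(3) vs(1,2) by (auto simp: run_simps)
  then have "halts (length ws + 1) (list_step (q, r # ws, ls, vs @ rs)) False"
    using Cons.IH[OF vs(3,4)] halts_rejecting by (auto simp del: list_step.simps)
  from halts_step[OF this] show ?case by simp
qed

lemma halts_final:
  assumes "cells vs"
  shows "halts (length vs + 1) (q_final, [], ls, vs @ [end_marker]) (todo \<notin> set vs)"
  using assms
proof (induction vs arbitrary: ls)
  case Nil
  have "halts 0 (list_step (q_final, [], ls, [end_marker])) True"
    using halts_accepting by (simp add: run_simps)
  from halts_step[OF this] show ?case by simp
next
  case (Cons v vs)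
  have "halts (length vs + 1) (list_step (q_final, [], ls, (v # vs) @ [end_marker]))
    (todo \<notin> set (v # vs))"
  proof (cases "v = todo")
    case True
    then have "list_step (q_final, [], ls, (v # vs) @ [end_marker]) =
      (reject_state, [], ls, (v # vs) @ [end_marker])" by (simp add: run_simps)
    then show ?thesis using True halts_rejecting by (simp del: list_step.simps)
  next
    case False
    then have "list_step (q_final, [], ls, (v # vs) @ [end_marker]) =
      (q_final, [], v # ls, vs @ [end_marker])"
      using Cons.prems by (auto simp: run_simps cells_def)
    then show ?thesis using False Cons by (simp add: cells_def del: list_step.simps)
  qed
  from halts_step[OF this] show ?case by simp
qed

text \<open>A row costs \<open>2 * length vs + 3\<close> steps and consumes
  \<open>length vs + 1\<close> bits, so three steps per bit suffice; the remaining
  \<open>length vs + 2\<close> pay for the final pass.\<close>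

lemma halts_rows:
  assumes "cells vs"
  shows "halts (3 * length ws + length vs + 2)
    (q_row, ws, [end_marker], vs @ [end_marker]) (check vs ws)"
  using assms
proof (induction vs ws rule: check.induct)
  case (1 vs)
  have "list_step (q_row, [], [end_marker], vs @ [end_marker]) =
    (q_final, [], [end_marker], vs @ [end_marker])"
    by (cases vs) (auto simp: run_simps)
  then show ?case using halts_step[of "length vs + 1"] halts_final[OF 1] by simp
next
  case (2 vs b ws)
  show ?case
  proof (cases "length vs \<le> length ws")
    case True
    let ?row = "take (length vs) ws" and ?ws = "drop (length vs) ws"
    have len: "length ?row = length vs" using True by simp
    have "halts (3 * length ?ws + length vs + 2)
      (q_row, ?ws, [end_marker], update ?row vs @ [end_marker]) (check vs (b # ws))"
      if "\<not> (b \<and> hits ?row vs > 0)"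
      using 2 that True cells_update[OF len] length_update[OF len] by simp
    then have "halts (3 * length ?ws + length vs + 2 + 2 * length vs + 3)
      (q_row, b # ?row @ ?ws, [end_marker], vs @ [end_marker]) (check vs (b # ws))"
      using len 2(2) by (intro halts_row) auto
    then show ?thesis
      using True by (auto simp del: check.simps elim!: halts_mono)
  next
    case False
    have "list_step (q_row, b # ws, [end_marker], vs @ [end_marker]) =
      (if b then q_forbid else q_none, ws, [end_marker], vs @ [end_marker])"
      by (cases vs) (auto simp: run_simps)
    moreover have "halts (length ws + 1)
      (if b then q_forbid else q_none, ws, [end_marker], vs @ [end_marker]) False"
      using False 2(2) by (intro halts_short) auto
    ultimately have "halts (Suc (length ws + 1))
      (q_row, b # ws, [end_marker], vs @ [end_marker]) False"
      by (intro halts_step) (simp del: list_step.simps)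
    then show ?thesis using False by (auto elim!: halts_mono)
  qed
qed

section \<open>Setting up the second tape, and the complete run\<close>

lemma halts_load:
  assumes "length u = length vs" and "cells vs"
    and "halts n (q_load, ws, rev (initial_cells u) @ ls, rs) b"
  shows "halts (n + length vs) (q_load, u @ ws, ls, vs @ rs) b"
  using assms
proof (induction u vs arbitrary: ls rule: list_induct2)
  case (Cons r u v vs)
  then have "halts (n + length vs)
    (q_load, u @ ws, (if r then todo else out) # ls, vs @ rs) b"
    by (simp add: cells_def initial_cells_def)
  then have "halts (n + length vs) (list_step (q_load, (r # u) @ ws, ls, (v # vs) @ rs)) b"
    using Cons.prems(1) by (auto simp: run_simps cells_def)
  from halts_step[OF this] show ?case by simp
qed (simp add: initial_cells_def)

text \<open>The second tape grows to the left into blank cells: the list on the left stays empty,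
  and the explicit 0 is the blank under the head.\<close>

lemma halts_unary:
  assumes "halts n (q_unary, ws, [], 0 # replicate k out @ rs) b"
  shows "halts (n + k) (q_unary, replicate k True @ ws, [], 0 # rs) b"
  using assms
proof (induction k arbitrary: rs)
  case (Suc k)
  have "halts n (q_unary, ws, [], 0 # replicate k out @ out # rs) b"
    using Suc.prems by (simp add: replicate_app_Cons_same)
  from Suc.IH[OF this]
  have "halts (n + k) (list_step (q_unary, replicate (Suc k) True @ ws, [], 0 # rs)) b"
    by (simp add: run_simps)
  from halts_step[OF this] show ?case by simp
qed simp

lemma list_step_start: "list_step (q_start, w, [], []) = (q_unary, w, [], [0, end_marker])"
  by (simp add: run_simps)

lemma halts_all_True: "halts (n + 2) (q_start, replicate n True, [], []) False"
proof -
  let ?rs = "0 # replicate n out @ [end_marker]"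
  have "list_step (q_unary, [], [], ?rs) = (reject_state, [], [], ?rs)" by (simp add: run_simps)
  then have "halts 1 (q_unary, [], [], ?rs) False"
    using halts_step[of 0] halts_rejecting by simp
  from halts_unary[OF this]
  show ?thesis
    using halts_step[of "1 + n" "(q_start, replicate n True, [], [])"]
    unfolding list_step_start by (simp add: add.commute)
qed

lemma halts_unary_prefix:
  "halts (2 * n + 4 * length ws + 6) (q_start, replicate n True @ False # ws, [], [])
     (n \<le> length ws \<and> check (initial_cells (take n ws)) (drop n ws))"
  (is "halts _ _ ?result")
proof -
  let ?rs = "replicate n out @ [end_marker]"
  \<comment> \<open>The cells laid down by the unary prefix measure out \<open>n\<close> further
    bits. Loading, returning and checking take \<open>3 * length ws + 4\<close> steps if the bits
    suffice; otherwise \<open>halts_short\<close> applies.\<close>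
  have load: "halts (n + 4 * length ws + 4) (q_load, ws, [end_marker], ?rs) ?result"
  proof (cases "n \<le> length ws")
    case True
    let ?u = "initial_cells (take n ws)"
    have u: "cells ?u" "length ?u = n" using True by (auto simp: cells_def initial_cells_def)
    then have "end_marker \<notin> set ?u" "map undo ?u = ?u"
      by (auto simp: cells_def intro!: map_idI)
    then have "halts (3 * length (drop n ws) + n + 2 + length ?u + 2)
      (q_load, drop n ws, rev ?u @ [end_marker], [end_marker]) ?result"
      using True halts_rows[OF u(1), of "drop n ws"] u(2) by (intro halts_turn_undo) auto
    then have "halts (3 * length (drop n ws) + n + 2 + length ?u + 2 + length (replicate n out))
      (q_load, take n ws @ drop n ws, [end_marker], ?rs) ?result"
      using True by (intro halts_load) (auto simp: cells_def)
    then show ?thesis using True u(2) by (auto elim!: halts_mono)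
  next
    case False
    then have "halts (length ws + 1) (q_load, ws, [end_marker], ?rs) False"
      by (intro halts_short) (auto simp: cells_def)
    then show ?thesis using False by (auto elim!: halts_mono)
  qed
  \<comment> \<open>The separator becomes the left end marker.\<close>
  have "list_step (q_unary, False # ws, [], 0 # ?rs) = (q_load, ws, [end_marker], ?rs)"
    by (simp add: run_simps)
  then have "halts (Suc (n + 4 * length ws + 4)) (q_unary, False # ws, [], 0 # ?rs) ?result"
    using load by (intro halts_step) (simp del: list_step.simps)
  from halts_unary[OF this]
  have "halts (Suc (n + 4 * length ws + 4) + n)
    (list_step (q_start, replicate n True @ False # ws, [], [])) ?result"
    unfolding list_step_start .
  from halts_step[OF this] show ?thesis by (auto elim!: halts_mono)
qed

lemma replicate_True_conv: "False \<notin> set w \<Longrightarrow> w = replicate (length w) True"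
  by (induction w) auto

lemma unary_prefix_cases:
  obtains n where "w = replicate n True" | n ws where "w = replicate n True @ False # ws"
proof (cases "False \<in> set w")
  case True
  then obtain us ws where "w = us @ False # ws" "False \<notin> set us"
    using split_list_first by metis
  then show thesis using that(2)[of "length us" ws] replicate_True_conv[of us] by simp
next
  case False
  then show thesis using that(1) replicate_True_conv by blast
qed

theorem theorem6: "ext_rhs_language \<in> PTIME"
proof -
  \<comment> \<open>The polynomial is \<open>6 + 4 * length w\<close>. Since \<open>length w\<close>
    is \<open>n\<close> or \<open>n + 1 + length ws\<close>, it dominates both \<open>n + 2\<close>
    and \<open>2 * n + 4 * length ws + 6\<close>.\<close>
  have "halts (poly [:6, 4:] (length w)) (q_start, w, [], []) (w \<in> ext_rhs_language)" for w
  proof (cases w rule: unary_prefix_cases)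
    case (1 n)
    then show ?thesis
      using halts_mono[OF halts_all_True[of n]]
      by (simp add: replicate_True_notin_ext_rhs_language)
  next
    case (2 n ws)
    show ?thesis
      unfolding 2 mem_ext_rhs_language_iff by (rule halts_mono[OF halts_unary_prefix]) simp
  qed
  then have "decides_in_time machine ext_rhs_language (poly [:6, 4:])"
    by (rule decides_in_time_machine)
  then show ?thesis unfolding PTIME_def using is_tm_machine by blast
qed

end
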